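(* Let $A>0$, $B>0$, $k\in\mathbb R\setminus\{0\}$, $S=A+B$, $R=A-B$, and $$H(\chi)=-2\chi^4+2Sk^2\chi^3+(4k^2-3Rk^3)\chi^2+Rk^5-2k^4 .$$ Then the quartic equation $H(\chi)=0$ has at least two real roots, counted with multiplicity. Consequently, away from parameter values at which roots coalesce (i.e. when the four complex roots of $H$ are distinct), the only possible root distributions are: four real roots, or two real roots and one nonreal complex-conjugate pair. *)

theory Defs
  imports Complex_Main "HOL-Computational_Algebra.Computational_Algebra"
begin

definition H :: "real \<Rightarrow> real \<Rightarrow> real \<Rightarrow> real poly" where
  "H A B k = (let S = A + B; R = A - B in
     [: R * k ^ 5 - 2 * k ^ 4, 0, 4 * k\<^sup>2 - 3 * R * k ^ 3, 2 * S * k\<^sup>2, - 2 :])"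

lemma poly_H:
  assumes "S = A + B" and "R = A - B"
  shows "poly (H A B k) x =
    - 2 * x ^ 4 + 2 * S * k\<^sup>2 * x ^ 3 + (4 * k\<^sup>2 - 3 * R * k ^ 3) * x\<^sup>2 + R * k ^ 5 - 2 * k ^ 4"
  unfolding H_def Let_def assms by (simp add: algebra_simps eval_nat_numeral)

definition complex_roots :: "real poly \<Rightarrow> complex set" where
  "complex_roots p = {z. poly (map_poly complex_of_real p) z = 0}"

end

theory Submission
  imports Defs "HOL-Real_Asymp.Real_Asymp"
begin

text \<open>
  The value \<open>H(\<bar>k\<bar>) = 2 (S \<bar>k\<bar>^5 - R k^5)\<close> is positive because \<open>\<bar>R\<bar> < S\<close>, while the leading
  coefficient \<open>-2\<close> makes the quartic negative near \<open>\<plusminus>\<infinity>\<close>; so there is a real root on each side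
  of \<open>\<bar>k\<bar>\<close>. Nonreal roots of a real polynomial come in conjugate pairs, which leaves room for
  at most one such pair among four distinct roots.
\<close>

lemma poly_H_abs_pos:
  assumes "A > 0" and "B > 0" and "k \<noteq> 0"
  shows "poly (H A B k) \<bar>k\<bar> > 0"
\<comment> \<open>At \<open>\<bar>k\<bar>\<close> the \<open>k ^ 4\<close> terms cancel. What is
  left is \<open>2 * (S - R) * k ^ 5\<close> for positive \<open>k\<close> and
  \<open>2 * (S + R) * (- k) ^ 5\<close> for negative \<open>k\<close>, where
  \<open>S - R = 2 * B\<close> and \<open>S + R = 2 * A\<close>.\<close>
proof (cases "k > 0")
  case True
  then have "poly (H A B k) \<bar>k\<bar> = 4 * B * k ^ 5"
    by (simp add: poly_H[OF refl refl] algebra_simps eval_nat_numeral)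
  with True assms show ?thesis by simp
next
  case False
  then have "poly (H A B k) \<bar>k\<bar> = 4 * A * (- k) ^ 5"
    by (simp add: poly_H[OF refl refl] algebra_simps eval_nat_numeral)
  moreover have "4 * A * (- k) ^ 5 > 0"
    using False assms by (intro mult_pos_pos zero_less_power) auto
  ultimately show ?thesis by (simp only:)
qed

text \<open>The term in \<open>x ^ 4\<close> dominates and has even degree, so the signs of
  \<open>a\<close>, \<open>b\<close> and \<open>c\<close> do not affect either end.\<close>

lemma quartic_neg_at_infinity:
  fixes a b c :: real
  defines "f \<equiv> \<lambda>x. - 2 * x ^ 4 + a * x ^ 3 + b * x\<^sup>2 + c"
  shows "eventually (\<lambda>x. f x < 0) at_top" and "eventually (\<lambda>x. f x < 0) at_bot"
  unfolding f_def by real_asymp+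

lemma H_two_real_roots:
  assumes "A > 0" and "B > 0" and "k \<noteq> 0"
  obtains x y where "x < y" and "poly (H A B k) x = 0" and "poly (H A B k) y = 0"
proof -
  define f where "f = poly (H A B k)"
  \<comment> \<open>The constant terms are grouped into one summand to match the shape in
    \<open>quartic_neg_at_infinity\<close>.\<close>
  have f_eq: "f x = - 2 * x ^ 4 + 2 * (A + B) * k\<^sup>2 * x ^ 3
      + (4 * k\<^sup>2 - 3 * (A - B) * k ^ 3) * x\<^sup>2 + ((A - B) * k ^ 5 - 2 * k ^ 4)" for x
    unfolding f_def by (simp add: poly_H[OF refl refl])
  have pos: "f \<bar>k\<bar> > 0"
    unfolding f_def using assms by (rule poly_H_abs_pos)
  have "eventually (\<lambda>x. f x < 0 \<and> x > \<bar>k\<bar>) at_top"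
    unfolding f_eq by (intro eventually_conj quartic_neg_at_infinity eventually_gt_at_top)
  then obtain v where v: "f v < 0" "\<bar>k\<bar> < v"
    using eventually_happens trivial_limit_at_top_linorder by blast
  have "eventually (\<lambda>x. f x < 0 \<and> x < \<bar>k\<bar>) at_bot"
    unfolding f_eq by (intro eventually_conj quartic_neg_at_infinity eventually_gt_at_bot)
  then obtain u where u: "f u < 0" "u < \<bar>k\<bar>"
    using eventually_happens trivial_limit_at_bot_linorder by blast
  obtain x where "x < \<bar>k\<bar>" "f x = 0"
    using poly_IVT_pos[of u "\<bar>k\<bar>" "H A B k"] u pos unfolding f_def by blast
  moreover obtain y where "\<bar>k\<bar> < y" "f y = 0"
    using poly_IVT_neg[of "\<bar>k\<bar>" v "H A B k"] v pos unfolding f_def by blast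
  ultimately show thesis
    using that[of x y] unfolding f_def by simp
qed

text \<open>Conjugation fixes the real coefficients, so it commutes with evaluation.\<close>

lemma cnj_complex_roots:
  assumes "z \<in> complex_roots p"
  shows "cnj z \<in> complex_roots p"
proof -
  have "poly (map_poly complex_of_real p) (cnj z) = cnj (poly (map_poly complex_of_real p) z)"
    by (induction p) (auto simp: map_poly_pCons)
  with assms show ?thesis by (simp add: complex_roots_def)
qed

text \<open>This lets real roots be counted inside the set of complex roots, since the embedding of
  the reals is injective.\<close>

lemma complex_roots_Int_Reals:
  "complex_roots p \<inter> \<real> = complex_of_real ` {x. poly p x = 0}"
proof -
  have "poly (map_poly complex_of_real p) (of_real x) = of_real (poly p x)" for x
    by (induction p) (auto simp: map_poly_pCons)
  then show ?thesis by (auto simp: complex_roots_def Reals_def)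
qed

theorem theorem8:
  fixes A B k :: real
  assumes "A > 0" and "B > 0" and "k \<noteq> 0"
  shows "size (proots (H A B k)) \<ge> 2 \<and>
    (card (complex_roots (H A B k)) = 4 \<longrightarrow>
       card {x :: real. poly (H A B k) x = 0} = 4 \<or>
       (card {x :: real. poly (H A B k) x = 0} = 2 \<and>
          (\<exists>w. w \<notin> \<real> \<and> complex_roots (H A B k) - \<real> = {w, cnj w})))"
proof (intro conjI impI)
  let ?p = "H A B k"
  let ?R = "{x :: real. poly ?p x = 0}"
  have nz: "?p \<noteq> 0" by (auto simp: H_def Let_def)
  have "finite ?R" using nz by (rule poly_roots_finite)
  obtain x y where "x < y" "x \<in> ?R" "y \<in> ?R"
    using H_two_real_roots[OF assms] by blast
  then have "card {x, y} \<le> card ?R"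
    using \<open>finite ?R\<close> by (intro card_mono) auto
  with \<open>x < y\<close> have two: "2 \<le> card ?R" by simp
  \<comment> \<open>Distinct roots form the support of the multiset of roots, and counting
    multiplicity can only increase their number.\<close>
  also have "?R = set_mset (proots ?p)" using nz by simp
  also have "card \<dots> \<le> size (proots ?p)"
    by (metis mset_set_set_mset_msubset size_mset_mono size_mset_set)
  finally show "2 \<le> size (proots ?p)" .

  assume four: "card (complex_roots ?p) = 4"
  let ?N = "complex_roots ?p - \<real>"
  \<comment> \<open>An infinite set has \<open>card\<close> 0, so cardinality 4 forces
    finiteness.\<close>
  have fin: "finite (complex_roots ?p)"
    using four by (simp add: card_ge_0_finite)
  have "card (complex_roots ?p \<inter> \<real>) = card ?R"
    unfolding complex_roots_Int_Reals by (intro card_image inj_onI) simp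
  then have sum: "card ?R + card ?N = 4"
    using four card_Int_Diff[OF fin, of \<real>] by simp
  show "card ?R = 4 \<or> (card ?R = 2 \<and> (\<exists>w. w \<notin> \<real> \<and> ?N = {w, cnj w}))"
  proof (cases "?N = {}")
    case True
    then have "card ?N = 0" by (metis card.empty)
    then show ?thesis using sum by simp
  next
    case False
    then obtain w where w: "w \<in> complex_roots ?p" "w \<notin> \<real>" by blast
    then have "cnj w \<noteq> w" by (simp add: Reals_cnj_iff)
    have sub: "{w, cnj w} \<subseteq> ?N"
      using w cnj_complex_roots by (auto simp: complex_is_Real_iff)
    have "card {w, cnj w} = 2" using \<open>cnj w \<noteq> w\<close> by simp
    moreover have "card {w, cnj w} \<le> card ?N"
      using fin sub by (intro card_mono) auto
    \<comment> \<open>The pair gives at least two nonreal roots and \<open>two\<close> at least two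
      real ones; as the total is 4, both bounds are attained.\<close>
    ultimately have "card ?N = 2" "card ?R = 2" using sum two by linarith+
    moreover have "{w, cnj w} = ?N"
      using fin sub \<open>card {w, cnj w} = 2\<close> \<open>card ?N = 2\<close> by (intro card_subset_eq) auto
    ultimately show ?thesis using w by blast
  qed
qed

end
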